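(* Let $n,q$ be positive integers, let $\mathcal{S}\subseteq GL(V)$ be the stabilizer of $IMM_q^n\in S^nV$, and let $\mathcal{S}_0$ be the connected component of the identity in $\mathcal{S}$. Let $P\in S^nV$ be a polynomial that is stabilized by $\mathcal{S}_0$ (i.e. $g\cdot P=P$ for all $g\in\mathcal{S}_0$). Then $P=c\,IMM_q^n$ for some $c\in\mathbb{C}$.
   Context: Let $U_1,\dots,U_n$ be complex vector spaces of dimension $q$, with indices read modulo $n$ (so $U_{n+1}=U_1$). Put $A_\alpha=U_\alpha^*\otimes U_{\alpha+1}=\mathrm{Hom}(U_\alpha,U_{\alpha+1})$ and $V=A_1^*\oplus\cdots\oplus A_n^*$, so $V^*=A_1\oplus\cdots\oplus A_n$ is the space of $n$-tuples $(X_1,\dots,X_n)$ of linear maps $X_\alpha:U_\alpha\to U_{\alpha+1}$. $IMM_q^n\in S^nV$ is the degree-$n$ homogeneous polynomial on $V^*$ given by $IMM_q^n(X_1,\dots,X_n)=\mathrm{trace}(X_n\cdots X_1)$. $GL(V)$ acts naturally on $S^nV$. *)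

theory Defs
  imports "HOL-Analysis.Analysis"
begin

text \<open>
  The ordered index set \<open>1, \<dots>, n\<close> is a finite linearly ordered type \<open>'n\<close>, so \<open>n = CARD('n)\<close>,
  and each \<open>U\<^sub>\<alpha>\<close> is \<open>\<complex>\<^sup>q\<close> with \<open>q = CARD('q)\<close>. A point of the dual of \<open>V\<close>, i.e. a tuple
  \<open>(X\<^sub>1, \<dots>, X\<^sub>n)\<close> of \<open>q \<times> q\<close> matrices, is its vector of entries indexed by \<open>(\<alpha>, i, j)\<close>; elements
  of \<open>V\<close> are coordinate vectors with respect to the dual basis of coordinate functions.
\<close>

type_synonym ('n, 'q) tuple_space = "complex ^ ('n \<times> 'q \<times> 'q)"

definition component :: "('n::finite, 'q::finite) tuple_space \<Rightarrow> 'n \<Rightarrow> complex ^ 'q ^ 'q" where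
  "component x \<alpha> = (\<chi> i j. x $ (\<alpha>, i, j))"

text \<open>The fold multiplies each new factor on the left, giving \<open>X\<^sub>n \<cdots> X\<^sub>1\<close>.\<close>

definition IMM :: "('n::{finite,linorder}, 'q::finite) tuple_space \<Rightarrow> complex" where
  "IMM x = trace (fold (\<lambda>\<alpha> M. component x \<alpha> ** M) (sorted_list_of_set (UNIV :: 'n set)) (mat 1))"

text \<open>
  The symmetric power \<open>S\<^sup>d V\<close> for \<open>V\<close> with coordinates indexed by \<open>'k\<close>, as homogeneous
  polynomials of degree \<open>d\<close> on the dual of \<open>V\<close>. Over the complex numbers a polynomial is
  determined by its function.
\<close>

definition sym_power :: "nat \<Rightarrow> (complex ^ 'k::finite \<Rightarrow> complex) set" where
  "sym_power d = {P. \<exists>c :: ('k \<Rightarrow> nat) \<Rightarrow> complex.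
     P = (\<lambda>x. \<Sum>m | sum m UNIV = d. c m * (\<Prod>i\<in>UNIV. x $ i ^ m i))}"

lemma finite_exponents: "finite {m :: 'k::finite \<Rightarrow> nat. sum m UNIV = d}"
proof (rule finite_subset)
  show "{m :: 'k \<Rightarrow> nat. sum m UNIV = d} \<subseteq> (UNIV :: 'k set) \<rightarrow>\<^sub>E {..d}"
    by (auto simp: PiE_def extensional_def intro: member_le_sum)
  show "finite ((UNIV :: 'k set) \<rightarrow>\<^sub>E {..d})"
    by (rule finite_PiE) auto
qed

text \<open>
  The action of \<open>GL(V)\<close> on polynomials on the dual of \<open>V\<close> extending its action on linear forms
  (see \<open>act_linear_form\<close>): \<open>g\<close> operates on the dual by its transpose.
\<close>

definition act :: "complex ^ 'k ^ 'k::finite \<Rightarrow> (complex ^ 'k \<Rightarrow> complex) \<Rightarrow> complex ^ 'k \<Rightarrow> complex" where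
  "act g P = (\<lambda>x. P (transpose g *v x))"

lemma act_linear_form:
  "act g (\<lambda>x. \<Sum>i\<in>UNIV. v $ i * x $ i) = (\<lambda>x. \<Sum>i\<in>UNIV. (g *v v) $ i * x $ i)"
proof
  fix x :: "complex ^ 'a"
  have "(\<Sum>i\<in>UNIV. v $ i * (\<Sum>j\<in>UNIV. g $ j $ i * x $ j))
      = (\<Sum>i\<in>UNIV. \<Sum>j\<in>UNIV. g $ j $ i * v $ i * x $ j)"
    by (simp add: sum_distrib_left mult_ac)
  also have "\<dots> = (\<Sum>j\<in>UNIV. \<Sum>i\<in>UNIV. g $ j $ i * v $ i * x $ j)"
    by (rule sum.swap)
  finally show "act g (\<lambda>x. \<Sum>i\<in>UNIV. v $ i * x $ i) x = (\<Sum>i\<in>UNIV. (g *v v) $ i * x $ i)"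
    by (simp add: act_def matrix_vector_mult_def transpose_def sum_distrib_right)
qed

lemma act_mult: "act (g ** h) P = act g (act h P)"
  by (simp add: act_def matrix_transpose_mul matrix_vector_mul_assoc del: transpose_matrix_vector)

definition stabilizer :: "(complex ^ 'k::finite \<Rightarrow> complex) \<Rightarrow> (complex ^ 'k ^ 'k) set" where
  "stabilizer P = {g. invertible g \<and> act g P = P}"

text \<open>
  Identity component in the Euclidean topology; for a complex algebraic group it agrees with the
  one in the Zariski topology.
\<close>

definition stabilizer0 :: "(complex ^ 'k::finite \<Rightarrow> complex) \<Rightarrow> (complex ^ 'k ^ 'k) set" where
  "stabilizer0 P = connected_component_set (stabilizer P) (mat 1)"

end

theory Submission imports Defs begin

text \<open>
  The tuples \<open>(h\<^sub>1, \<dots>, h\<^sub>n)\<close> of invertible matrices act by \<open>X\<^sub>\<alpha> \<mapsto> h\<^sub>\<alpha>\<^sub>+\<^sub>1 X\<^sub>\<alpha> h\<^sub>\<alpha>\<inverse>\<close> and preserve \<open>IMM\<close>.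
  They are joined to the identity along \<open>(1 - z) I + z h\<^sub>\<alpha>\<close>, where \<open>z\<close> ranges over \<open>\<complex>\<close> minus finitely
  many points, so they lie in the identity component. If \<open>X\<^sub>1, \<dots>, X\<^sub>n\<^sub>-\<^sub>1\<close> are invertible, this action
  moves \<open>(X\<^sub>1, \<dots>, X\<^sub>n)\<close> to \<open>(1, \<dots>, 1, X\<^sub>n \<cdots> X\<^sub>1)\<close>, so an invariant \<open>P\<close> satisfies
  \<open>P X = f (X\<^sub>n \<cdots> X\<^sub>1)\<close> with \<open>f M = P (1, \<dots>, 1, M)\<close>. As \<open>P\<close> has degree \<open>n\<close>, we get
  \<open>f (s\<^sup>n M) = s\<^sup>n f M\<close>; hence \<open>f\<close> is homogeneous of degree 1 and, being differentiable at 0, linear.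
  Conjugation invariance makes it a multiple of the trace, and density extends \<open>P = c IMM\<close> to all \<open>X\<close>.
\<close>

section \<open>Scalar matrices, continuity of inversion, and singular matrices on a line\<close>

lemma mat_mult_left: "mat s ** A = (\<chi> i j. s * A $ i $ j)"
  for A :: "'a::comm_semiring_1 ^ 'n ^ 'm::finite"
  by (simp add: vec_eq_iff matrix_matrix_mult_def mat_def if_distrib[where f="\<lambda>x. x * _"] cong: if_cong)

lemma matrix_add_mult_distrib: "(A + B) ** C = A ** C + B ** C"
  for A B :: "'a::semiring_1 ^ 'n ^ 'm::finite"
  by (simp add: vec_eq_iff matrix_matrix_mult_def distrib_right sum.distrib)

lemma mat_mult_commute: "A ** mat s = mat s ** A"
  for A :: "'a::comm_semiring_1 ^ 'n ^ 'n::finite"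
proof -
  have "A ** mat s = (\<chi> i j. s * A $ i $ j)"
    by (simp add: vec_eq_iff matrix_matrix_mult_def mat_def if_distrib[where f="\<lambda>x. _ * x"] mult.commute cong: if_cong)
  then show ?thesis
    by (simp add: mat_mult_left)
qed

lemma mat_mult_mat: "mat s ** mat t = (mat (s * t) :: 'a::comm_semiring_1 ^ 'n ^ 'n::finite)"
  by (simp add: mat_mult_left) (simp add: vec_eq_iff mat_def)

lemma invertible_mat: "s \<noteq> 0 \<Longrightarrow> invertible (mat s :: 'a::field ^ 'n ^ 'n::finite)"
  unfolding invertible_def by (rule exI[of _ "mat (inverse s)"]) (simp add: mat_mult_mat)

lemma matrix_inv:
  assumes "invertible A"
  shows matrix_inv_right: "A ** matrix_inv A = mat 1"
    and matrix_inv_left: "matrix_inv A ** A = mat 1"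
proof -
  have "A ** matrix_inv A = mat 1 \<and> matrix_inv A ** A = mat 1"
    using assms unfolding invertible_def matrix_inv_def by (rule someI_ex)
  then show "A ** matrix_inv A = mat 1" "matrix_inv A ** A = mat 1"
    by auto
qed

lemma matrix_inv_eqI:
  fixes A B :: "'a::field ^ 'n ^ 'n"
  assumes "A ** B = mat 1"
  shows "matrix_inv A = B"
proof -
  have "matrix_inv A ** A = mat 1"
    using assms by (auto simp: invertible_right_inverse intro!: matrix_inv_left)
  then have "matrix_inv A ** (A ** B) = B"
    by (simp add: matrix_mul_assoc)
  then show ?thesis
    by (simp add: assms)
qed

text \<open>Cramer's rule, applied to the columns of \<open>A ** matrix_inv A = mat 1\<close>.
  Quotients of determinants make the continuity of inversion visible.\<close>

lemma matrix_inv_entry: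
  fixes A :: "'a::field ^ 'n ^ 'n"
  assumes "invertible A"
  shows "matrix_inv A $ i $ j = det (\<chi> k l. if l = i then mat 1 $ k $ j else A $ k $ l) / det A"
proof -
  have "A *v column j (matrix_inv A) = column j (mat 1)"
    unfolding matrix_inv_right[OF assms, symmetric]
    by (simp add: vec_eq_iff column_def matrix_vector_mult_def matrix_matrix_mult_def)
  then have "column j (matrix_inv A)
      = (\<chi> m. det (\<chi> k l. if l = m then column j (mat 1) $ k else A $ k $ l) / det A)"
    using assms by (simp add: cramer invertible_det_nz)
  then have "column j (matrix_inv A) $ i
      = det (\<chi> k l. if l = i then column j (mat 1) $ k else A $ k $ l) / det A"
    by (simp only: vec_lambda_beta)
  then show ?thesis
    by (simp only: column_def vec_lambda_beta)
qed

lemma continuous_on_det: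
  fixes A :: "'b::topological_space \<Rightarrow> 'a::real_normed_field ^ 'n ^ 'n"
  assumes "\<And>i j. continuous_on S (\<lambda>z. A z $ i $ j)"
  shows "continuous_on S (\<lambda>z. det (A z))"
  unfolding det_def by (intro continuous_intros assms)

lemma continuous_on_matrix_inv_entry:
  fixes A :: "'b::topological_space \<Rightarrow> 'a::real_normed_field ^ 'n ^ 'n"
  assumes "\<And>i j. continuous_on S (\<lambda>z. A z $ i $ j)" "\<And>z. z \<in> S \<Longrightarrow> invertible (A z)"
  shows "continuous_on S (\<lambda>z. matrix_inv (A z) $ i $ j)"
proof -
  have "continuous_on S (\<lambda>z. det (\<chi> k l. if l = i then mat 1 $ k $ j else A z $ k $ l) / det (A z))"
  proof (intro continuous_on_divide continuous_on_det assms(1))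
    show "continuous_on S (\<lambda>z. (\<chi> k l. if l = i then mat 1 $ k $ j else A z $ k $ l) $ a $ b)" for a b
      using assms(1) by (cases "b = i") simp_all
  qed (use assms(2) in \<open>simp add: invertible_det_nz\<close>)
  then show ?thesis
    using assms(2) by (simp add: matrix_inv_entry cong: continuous_on_cong)
qed

text \<open>The determinant along the line is a polynomial in \<open>z\<close> with value 1 at 0, so
  it is nonzero and has finitely many roots. This supplies generic invertible matrices for the
  connectedness, trace and density arguments.\<close>

lemma finite_singular_segment:
  fixes A :: "'a::field ^ 'n ^ 'n"
  shows "finite {z. \<not> invertible (mat (1 - z) + mat z ** A)}"
proof -
  define p where "p = (\<Sum>\<pi> | \<pi> permutes (UNIV :: 'n set). smult (of_int (sign \<pi>))
    (\<Prod>i\<in>UNIV. [:mat 1 $ i $ \<pi> i, A $ i $ \<pi> i - mat 1 $ i $ \<pi> i:]))"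
  have p: "poly p z = det (mat (1 - z) + mat z ** A)" for z
    unfolding p_def det_def mat_mult_left
    by (auto simp: poly_sum poly_prod mat_def algebra_simps intro!: sum.cong prod.cong)
  have "poly p 0 = 1"
    by (simp add: p mat_mult_left)
  then have "p \<noteq> 0"
    by auto
  then show ?thesis
    using poly_roots_finite[of p] by (simp add: p invertible_det_nz)
qed

section \<open>Positions of the factors and partial products\<close>

definition pos :: "'n::{finite,linorder} \<Rightarrow> nat" where
  "pos = inv_into {..<CARD('n)} ((!) (sorted_list_of_set (UNIV :: 'n set)))"

lemma bij_betw_sorted_UNIV:
  "bij_betw ((!) (sorted_list_of_set (UNIV :: 'n::{finite,linorder} set))) {..<CARD('n)} UNIV"
  by (rule bij_betw_nth) auto

lemma pos_nth [simp]:
  "k < CARD('n) \<Longrightarrow> pos (sorted_list_of_set (UNIV :: 'n::{finite,linorder} set) ! k) = k"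
  unfolding pos_def using bij_betw_sorted_UNIV[where 'n='n]
  by (intro inv_into_f_f) (auto simp: bij_betw_def)

lemma pos_less [simp]: "pos (\<alpha> :: 'n::{finite,linorder}) < CARD('n)"
  unfolding pos_def
  using inv_into_into[of \<alpha> "(!) (sorted_list_of_set (UNIV :: 'n set))" "{..<CARD('n)}"]
    bij_betw_sorted_UNIV[where 'n='n]
  by (auto simp: bij_betw_def)

lemma nth_pos [simp]: "sorted_list_of_set UNIV ! pos \<alpha> = (\<alpha> :: 'n::{finite,linorder})"
  unfolding pos_def using bij_betw_sorted_UNIV[where 'n='n]
  by (intro f_inv_into_f) (auto simp: bij_betw_def)

definition partial_product :: "('n::{finite,linorder}, 'q::finite) tuple_space \<Rightarrow> nat \<Rightarrow> complex ^ 'q ^ 'q" where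
  "partial_product x k =
     fold (\<lambda>\<alpha> M. component x \<alpha> ** M) (take k (sorted_list_of_set (UNIV :: 'n set))) (mat 1)"

lemma partial_product_0 [simp]: "partial_product x 0 = mat 1"
  by (simp add: partial_product_def)

lemma partial_product_Suc:
  "k < CARD('n) \<Longrightarrow> partial_product (x :: ('n::{finite,linorder}, 'q::finite) tuple_space) (Suc k)
     = component x (sorted_list_of_set UNIV ! k) ** partial_product x k"
  by (simp add: partial_product_def take_Suc_conv_app_nth)

lemma IMM_partial_product:
  "IMM (x :: ('n::{finite,linorder}, 'q::finite) tuple_space) = trace (partial_product x CARD('n))"
  by (simp add: IMM_def partial_product_def)

lemma component_eqI: "(\<And>\<alpha>. component x \<alpha> = component y \<alpha>) \<Longrightarrow> x = y"
  by (auto simp: component_def vec_eq_iff)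

lemma component_scale: "component (s *s x) \<alpha> = mat s ** component x \<alpha>"
  by (simp add: component_def mat_mult_left)

section \<open>The gauge action and the invariance of the trace\<close>

text \<open>
  The matrix on the tuple space of \<open>X\<^sub>\<alpha> \<mapsto> h\<^sub>\<alpha>\<^sub>+\<^sub>1 X\<^sub>\<alpha> k\<^sub>\<alpha>\<close>, with positions in \<open>0, \<dots>, n - 1\<close>; the cyclic
  convention becomes the side condition \<open>h n = h 0\<close> at each use.
\<close>

definition gauge_matrix ::
  "(nat \<Rightarrow> complex ^ 'q ^ 'q) \<Rightarrow> (nat \<Rightarrow> complex ^ 'q ^ 'q) \<Rightarrow>
   complex ^ ('n \<times> 'q \<times> 'q) ^ ('n::{finite,linorder} \<times> 'q::finite \<times> 'q)" where
  "gauge_matrix h k = (\<chi> a b. if fst a = fst b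
     then h (Suc (pos (fst a))) $ fst (snd a) $ fst (snd b) * k (pos (fst a)) $ snd (snd b) $ snd (snd a)
     else 0)"

lemma component_gauge:
  "component (gauge_matrix h k *v x) \<alpha> = h (Suc (pos \<alpha>)) ** component x \<alpha> ** k (pos \<alpha>)"
  (is "?L = ?R")
proof -
  have "?L $ i $ j = ?R $ i $ j" for i j
  proof -
    have "?L $ i $ j = (\<Sum>\<beta>\<in>UNIV. \<Sum>a\<in>UNIV. \<Sum>b\<in>UNIV. if \<alpha> = \<beta>
        then h (Suc (pos \<alpha>)) $ i $ a * k (pos \<alpha>) $ b $ j * x $ (\<alpha>, a, b) else 0)"
      unfolding component_def gauge_matrix_def matrix_vector_mult_def UNIV_Times_UNIV[symmetric]
        sum.cartesian_product
      by (auto simp: split_beta intro!: sum.cong)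
    also have "\<dots> = (\<Sum>\<beta>\<in>UNIV. if \<alpha> = \<beta> then \<Sum>a\<in>UNIV. \<Sum>b\<in>UNIV.
        h (Suc (pos \<alpha>)) $ i $ a * k (pos \<alpha>) $ b $ j * x $ (\<alpha>, a, b) else 0)"
      by (intro sum.cong) auto
    also have "\<dots> = (\<Sum>b\<in>UNIV. \<Sum>a\<in>UNIV.
        h (Suc (pos \<alpha>)) $ i $ a * k (pos \<alpha>) $ b $ j * x $ (\<alpha>, a, b))"
      by simp (rule sum.swap)
    also have "\<dots> = ?R $ i $ j"
      by (simp add: matrix_matrix_mult_def component_def sum_distrib_right sum_distrib_left mult_ac)
    finally show ?thesis .
  qed
  then show ?thesis
    by (simp add: vec_eq_iff)
qed

lemma gauge_inverse:
  assumes "\<And>m. m \<le> CARD('n) \<Longrightarrow> h m ** k m = mat 1"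
  shows "gauge_matrix h k ** gauge_matrix k h = (mat 1 :: complex ^ ('n \<times> 'q \<times> 'q) ^ ('n::{finite,linorder} \<times> 'q::finite \<times> 'q))"
proof -
  have "gauge_matrix h k *v (gauge_matrix k h *v x) = x" for x :: "('n, 'q) tuple_space"
  proof (rule component_eqI)
    fix \<alpha> :: 'n
    have "h (Suc (pos \<alpha>)) ** k (Suc (pos \<alpha>)) = mat 1" "h (pos \<alpha>) ** k (pos \<alpha>) = mat 1"
      using assms[of "Suc (pos \<alpha>)"] assms[of "pos \<alpha>"] pos_less[of \<alpha>] by (auto simp: Suc_le_eq less_imp_le)
    then show "component (gauge_matrix h k *v (gauge_matrix k h *v x)) \<alpha> = component x \<alpha>"
      unfolding component_gauge
      by (metis matrix_mul_assoc matrix_mul_lid matrix_mul_rid)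
  qed
  then show ?thesis
    by (simp add: matrix_eq matrix_vector_mul_assoc[symmetric])
qed

text \<open>Telescoping: between neighbouring factors \<open>k m ** h m\<close> cancels, and only
  the two outer matrices survive.\<close>

lemma partial_product_gauge:
  fixes x :: "('n::{finite,linorder}, 'q::finite) tuple_space"
  assumes "\<And>m. m \<le> CARD('n) \<Longrightarrow> h m ** k m = mat 1" "m \<le> CARD('n)"
  shows "partial_product (gauge_matrix h k *v x) m = h m ** partial_product x m ** k 0"
  using assms(2)
proof (induction m)
  case 0
  then show ?case using assms(1)[of 0] by simp
next
  case (Suc m)
  have "k m ** h m = mat 1"
    using assms(1)[of m] Suc.prems matrix_left_right_inverse[of "h m" "k m"] by simp
  then have cancel: "A ** k m ** (h m ** B) = A ** B" for A B
    by (metis matrix_mul_assoc matrix_mul_rid)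
  show ?case
    using Suc
    by (simp add: partial_product_Suc component_gauge matrix_mul_assoc[of "h m", symmetric] cancel)
       (simp only: matrix_mul_assoc)
qed

text \<open>Since \<open>h\<close> agrees at both ends, the full product is merely conjugated by
  \<open>h 0\<close>, and the trace is cyclic.\<close>

lemma IMM_gauge:
  fixes x :: "('n::{finite,linorder}, 'q::finite) tuple_space"
  assumes "\<And>m. m \<le> CARD('n) \<Longrightarrow> h m ** k m = mat 1" "h CARD('n) = h 0"
  shows "IMM (gauge_matrix h k *v x) = IMM x"
proof -
  have "k 0 ** h 0 = mat 1"
    using assms(1)[of 0] matrix_left_right_inverse[of "h 0" "k 0"] by simp
  then have "trace (h 0 ** partial_product x CARD('n) ** k 0) = trace (partial_product x CARD('n))"
    by (metis trace_mul_sym matrix_mul_assoc matrix_mul_lid)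
  then show ?thesis
    using assms by (simp add: IMM_partial_product partial_product_gauge)
qed

section \<open>Gauge transformations lie in the identity component\<close>

lemma gauge_in_stabilizer:
  fixes h k :: "nat \<Rightarrow> complex ^ 'q ^ 'q::finite"
  assumes "\<And>m. m \<le> CARD('n) \<Longrightarrow> h m ** k m = mat 1" "h CARD('n) = h 0"
  shows "transpose (gauge_matrix h k) \<in> stabilizer (IMM :: ('n::{finite,linorder}, 'q) tuple_space \<Rightarrow> complex)"
proof -
  have "invertible (gauge_matrix h k :: complex ^ ('n \<times> 'q \<times> 'q) ^ ('n \<times> 'q \<times> 'q))"
    using gauge_inverse[of h k] assms(1) invertible_right_inverse by blast
  \<comment> \<open>The transpose undoes the one built into \<open>act\<close>, so points are moved
    by \<open>gauge_matrix h k\<close> itself.\<close>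
  moreover have "act (transpose (gauge_matrix h k)) IMM = (IMM :: ('n, 'q) tuple_space \<Rightarrow> complex)"
    unfolding act_def using IMM_gauge[OF assms] by auto
  ultimately show ?thesis
    by (simp add: stabilizer_def invertible_det_nz)
qed

lemma gauge_in_stabilizer0:
  fixes h k :: "nat \<Rightarrow> complex ^ 'q ^ 'q::finite"
  assumes hk: "\<And>m. m \<le> CARD('n) \<Longrightarrow> h m ** k m = mat 1" and cyc: "h CARD('n) = h 0"
  shows "transpose (gauge_matrix h k) \<in> stabilizer0 (IMM :: ('n::{finite,linorder}, 'q) tuple_space \<Rightarrow> complex)"
proof -
  define A where "A z m = mat (1 - z) + mat z ** h m" for z m
  define S where "S = - (\<Union>m\<le>CARD('n). {z. \<not> invertible (A z m)})"
  define \<phi> :: "complex \<Rightarrow> complex ^ ('n \<times> 'q \<times> 'q) ^ ('n \<times> 'q \<times> 'q)"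
    where "\<phi> z = transpose (gauge_matrix (A z) (\<lambda>m. matrix_inv (A z m)))" for z
  have inv: "invertible (A z m)" if "z \<in> S" "m \<le> CARD('n)" for z m
    using that by (auto simp: S_def)
  have A0: "A 0 m = mat 1" and A1: "A 1 m = h m" for m
    unfolding A_def mat_mult_left by (simp_all add: vec_eq_iff mat_def)
  have inv_h: "matrix_inv (h m) = k m" if "m \<le> CARD('n)" for m
    using hk[OF that] by (rule matrix_inv_eqI)
  have "countable (\<Union>m\<le>CARD('n). {z. \<not> invertible (A z m)})"
    unfolding A_def by (intro countable_finite finite_UN_I finite_atMost finite_singular_segment)
  \<comment> \<open>The complex parameter matters: the plane minus countably many points is
    connected, whereas singular points could cut a real segment.\<close>
  then have "connected S"
    unfolding S_def by (intro path_connected_imp_connected path_connected_complement_countable) auto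
  moreover have "continuous_on S \<phi>"
  proof -
    have A: "continuous_on S (\<lambda>z. A z m $ i $ j)" for m i j
      unfolding A_def mat_mult_left
      by (cases "i = j") (auto simp: mat_def intro!: continuous_intros)
    have "continuous_on S (\<lambda>z. matrix_inv (A z m) $ i $ j)" if "m \<le> CARD('n)" for m i j
      using A inv that by (intro continuous_on_matrix_inv_entry) auto
    then have "continuous_on S (\<lambda>z. \<phi> z $ a $ b)" for a b
      unfolding \<phi>_def gauge_matrix_def transpose_def
      by (cases "fst b = fst a") (auto simp: less_imp_le intro!: continuous_on_mult A)
    then have "continuous_on S (\<lambda>z. \<chi> a b. \<phi> z $ a $ b)"
      by (intro continuous_on_vec_lambda)
    then show ?thesis
      by simp
  qed
  ultimately have "connected (\<phi> ` S)"
    by (intro connected_continuous_image)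
  moreover have "\<phi> ` S \<subseteq> stabilizer IMM"
  proof
    fix g assume "g \<in> \<phi> ` S"
    then obtain z where z: "z \<in> S" "g = \<phi> z"
      by blast
    have "A z CARD('n) = A z 0"
      by (simp add: A_def cyc)
    then show "g \<in> stabilizer IMM"
      unfolding z(2) \<phi>_def by (intro gauge_in_stabilizer matrix_inv_right inv[OF z(1)])
  qed
  moreover have "mat 1 \<in> \<phi> ` S"
  proof (rule image_eqI)
    have "matrix_inv (mat 1 :: complex ^ 'q ^ 'q) = mat 1"
      by (rule matrix_inv_eqI) simp
    then have "gauge_matrix (A 0) (\<lambda>m. matrix_inv (A 0 m)) *v x = x" for x :: "('n, 'q) tuple_space"
      by (intro component_eqI) (simp add: component_gauge A0)
    then have "gauge_matrix (A 0) (\<lambda>m. matrix_inv (A 0 m)) = (mat 1 :: complex ^ ('n \<times> 'q \<times> 'q) ^ ('n \<times> 'q \<times> 'q))"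
      by (simp add: matrix_eq)
    then show "mat 1 = \<phi> 0"
      by (simp add: \<phi>_def)
    show "0 \<in> S"
      by (simp add: S_def A0 invertible_mat)
  qed
  moreover have "transpose (gauge_matrix h k) \<in> \<phi> ` S"
  proof (rule image_eqI)
    \<comment> \<open>\<open>gauge_matrix\<close> evaluates its second argument only at positions
      below \<open>CARD('n)\<close>, where \<open>matrix_inv (h m)\<close> is
      \<open>k m\<close>.\<close>
    have "gauge_matrix h k = (gauge_matrix (A 1) (\<lambda>m. matrix_inv (A 1 m)) :: complex ^ ('n \<times> 'q \<times> 'q) ^ ('n \<times> 'q \<times> 'q))"
      by (simp add: gauge_matrix_def A1 inv_h less_imp_le cong: if_cong)
    then show "transpose (gauge_matrix h k) = \<phi> 1"
      by (simp add: \<phi>_def)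
    show "1 \<in> S"
      using hk by (auto simp: S_def A1 invertible_right_inverse)
  qed
  ultimately show ?thesis
    unfolding stabilizer0_def by (meson connected_component_maximal subsetD)
qed

section \<open>Homogeneous functions, linearity and the trace\<close>

lemma sym_power_scale:
  assumes "P \<in> sym_power d"
  shows "P (s *s x) = s ^ d * P x"
proof -
  obtain c where c: "P = (\<lambda>x. \<Sum>m | sum m UNIV = d. c m * (\<Prod>i\<in>UNIV. x $ i ^ m i))"
    using assms by (auto simp: sym_power_def)
  have "(\<Prod>i\<in>UNIV. (s * x $ i) ^ m i) = s ^ d * (\<Prod>i\<in>UNIV. x $ i ^ m i)" if "sum m UNIV = d" for m
    using that by (simp add: power_mult_distrib prod.distrib power_sum[symmetric])
  then show ?thesis
    by (simp add: c sum_distrib_left mult.left_commute)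
qed

lemma sym_power_differentiable:
  assumes "P \<in> sym_power d"
  shows "P differentiable (at x within S)"
proof -
  obtain c where c: "P = (\<lambda>x. \<Sum>m | sum m UNIV = d. c m * (\<Prod>i\<in>UNIV. x $ i ^ m i))"
    using assms by (auto simp: sym_power_def)
  have "(\<lambda>x. \<Prod>i\<in>UNIV. x $ i ^ m i) differentiable (at x within S)" for m
    unfolding differentiable_def
    by (rule exI, rule has_derivative_prod, rule has_derivative_power,
        rule bounded_linear.has_derivative[OF bounded_linear_vec_nth], rule has_derivative_ident)
  then show ?thesis
    unfolding c by (intro differentiable_sum differentiable_mult differentiable_const finite_exponents) auto
qed

text \<open>A function homogeneous of degree 1 is its own derivative at 0.\<close>

lemma linear_if_homogeneous_differentiable:
  fixes f :: "'a::real_normed_vector \<Rightarrow> 'b::real_normed_vector"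
  assumes f: "f differentiable (at 0)" and hom: "\<And>t x. t > 0 \<Longrightarrow> f (t *\<^sub>R x) = t *\<^sub>R f x"
  shows "linear f"
proof -
  obtain D where D: "(f has_derivative D) (at 0)"
    using f by (auto simp: differentiable_def)
  have "f 0 = 2 *\<^sub>R f 0"
    using hom[of 2 0] by simp
  then have f0: "f 0 = 0"
    by (simp add: scaleR_2)
  have "f x = D x" for x
  proof -
    have "((\<lambda>t. f (t *\<^sub>R x)) has_derivative (\<lambda>t. D (t *\<^sub>R x))) (at 0)"
      by (rule has_derivative_compose[where g=f]) (auto intro!: derivative_eq_intros D)
    then have "((\<lambda>t. f (t *\<^sub>R x)) has_vector_derivative D x) (at 0)"
      using has_derivative_linear[OF D] by (simp add: has_vector_derivative_def linear_cmul)
    \<comment> \<open>Homogeneity is assumed for positive \<open>t\<close> only, so the derivatives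
      are compared along the ray, from the right of 0.\<close>
    then have "((\<lambda>t. f (t *\<^sub>R x)) has_vector_derivative D x) (at 0 within {0..})"
      by (rule has_vector_derivative_at_within)
    then have "((\<lambda>t. t *\<^sub>R f x) has_vector_derivative D x) (at 0 within {0..})"
      by (rule has_vector_derivative_transform[rotated -1])
         (use hom f0 in \<open>auto simp: order_le_less\<close>)
    moreover have "((\<lambda>t. t *\<^sub>R f x) has_vector_derivative f x) (at 0 within {0..})"
      by (auto intro!: derivative_eq_intros)
    ultimately show ?thesis
      by (intro vector_derivative_unique_within[of 0 "{0::real..}"]) (simp_all add: at_within_Ici_at_right)
  qed
  then have "f = D"
    by blast
  then show ?thesis
    using has_derivative_linear[OF D] by simp
qed

text \<open>
  A linear function with \<open>f (A ** B) = f (B ** A)\<close> kills \<open>E\<^sub>i\<^sub>j = E\<^sub>i\<^sub>i E\<^sub>i\<^sub>j\<close> for \<open>i \<noteq> j\<close> and agrees on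
  \<open>E\<^sub>i\<^sub>i = E\<^sub>i\<^sub>j E\<^sub>j\<^sub>i\<close> and \<open>E\<^sub>j\<^sub>j = E\<^sub>j\<^sub>i E\<^sub>i\<^sub>j\<close>.
\<close>

lemma conjugation_invariant_linear_is_trace:
  fixes f :: "complex ^ 'q ^ 'q::finite \<Rightarrow> complex"
  assumes lin: "linear f" and scale: "\<And>s M. f (mat s ** M) = s * f M"
    and conj: "\<And>A B M. A ** B = mat 1 \<Longrightarrow> f (A ** M ** B) = f M"
  shows "\<exists>c. \<forall>M. f M = c * trace M"
proof -
  have comm: "f (A ** B) = f (B ** A)" for A B
  proof -
    have inv_comm: "f (A ** B) = f (B ** A)" if "invertible A" for A
      using conj[of A "matrix_inv A" "B ** A"] matrix_inv_right[OF that]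
      by (metis matrix_mul_assoc matrix_mul_rid)
    \<comment> \<open>For arbitrary \<open>A\<close>, commutation is tested on an invertible matrix
      (1 - z) I + z A. The terms from I agree on both sides and cancel by additivity; excluding 0
      allows division by \<open>z\<close>.\<close>
    have "finite (insert 0 {z. \<not> invertible (mat (1 - z) + mat z ** A)})"
      by (intro finite.insertI finite_singular_segment)
    then obtain z where z: "z \<noteq> 0" "invertible (mat (1 - z) + mat z ** A)"
      using ex_new_if_finite[OF infinite_UNIV_char_0] by blast
    have "f (mat (1 - z) ** B + mat z ** (A ** B)) = f (mat (1 - z) ** B + mat z ** (B ** A))"
      using inv_comm[OF z(2)]
      by (simp add: matrix_add_ldistrib matrix_add_mult_distrib mat_mult_commute matrix_mul_assoc)
    then show ?thesis
      using z(1) by (simp add: linear_add[OF lin] scale)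
  qed
  define E :: "'q \<Rightarrow> 'q \<Rightarrow> complex ^ 'q ^ 'q" where "E i j = (\<chi> a b. if a = i \<and> b = j then 1 else 0)" for i j
  have E_mult: "E i j ** E k l = (if j = k then E i l else 0)" for i j k l
    by (auto simp: E_def vec_eq_iff matrix_matrix_mult_def if_distrib[where f="\<lambda>x. x * _"]
        cong: if_cong)
  have off: "f (E i j) = 0" if "i \<noteq> j" for i j
    using comm[of "E i i" "E i j"] that by (simp add: E_mult linear_0[OF lin])
  have diag: "f (E i i) = f (E j j)" for i j
    using comm[of "E i j" "E j i"] by (simp add: E_mult)
  obtain i0 :: 'q where True by simp
  have "f M = f (E i0 i0) * trace M" for M
  proof -
    have "M = (\<Sum>i\<in>UNIV. \<Sum>j\<in>UNIV. mat (M $ i $ j) ** E i j)"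
    proof -
      have "(\<Sum>x\<in>UNIV. \<Sum>y\<in>UNIV. if i = x \<and> j = y then M $ x $ y else 0)
          = (\<Sum>x\<in>UNIV. if i = x then \<Sum>y\<in>UNIV. if j = y then M $ x $ y else 0 else 0)" for i j
        by (intro sum.cong) auto
      then show ?thesis
        by (simp add: vec_eq_iff mat_mult_left E_def if_distrib[where f="\<lambda>x. _ * x"] cong: if_cong)
    qed
    then have "f M = f (\<Sum>i\<in>UNIV. \<Sum>j\<in>UNIV. mat (M $ i $ j) ** E i j)"
      by simp
    also have "\<dots> = (\<Sum>i\<in>UNIV. \<Sum>j\<in>UNIV. M $ i $ j * f (E i j))"
      by (simp add: linear_sum[OF lin] scale)
    also have "\<dots> = (\<Sum>i\<in>UNIV. \<Sum>j\<in>UNIV. if i = j then M $ i $ i * f (E i0 i0) else 0)"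
      using off diag by (intro sum.cong refl) (metis mult_zero_right)
    also have "\<dots> = f (E i0 i0) * trace M"
      by (simp add: trace_def sum_distrib_left mult.commute)
    finally show ?thesis .
  qed
  then show ?thesis by blast
qed

section \<open>The normal form under the gauge action\<close>

definition last_slot :: "complex ^ 'q ^ 'q \<Rightarrow> ('n::{finite,linorder}, 'q::finite) tuple_space" where
  "last_slot M = (\<chi> a. (if Suc (pos (fst a)) = CARD('n) then M else mat 1) $ fst (snd a) $ snd (snd a))"

lemma component_last_slot:
  "component (last_slot M :: ('n::{finite,linorder}, 'q::finite) tuple_space) \<alpha>
     = (if Suc (pos \<alpha>) = CARD('n) then M else mat 1)"
  by (simp add: component_def last_slot_def vec_eq_iff)

lemma last_slot_differentiable:
  "(last_slot :: _ \<Rightarrow> ('n::{finite,linorder}, 'q::finite) tuple_space) differentiable (at M within S)"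
proof -
  \<comment> \<open>\<open>last_slot\<close> is affine in \<open>M\<close> because of the fixed
    identity slots; subtracting its value at 0 leaves the linear part.\<close>
  have "bounded_linear (\<lambda>M. (last_slot M - last_slot 0) :: ('n, 'q) tuple_space)"
    unfolding linear_conv_bounded_linear[symmetric]
    by (intro linearI) (auto simp: last_slot_def vec_eq_iff)
  then have "(\<lambda>M. (last_slot M - last_slot 0) + last_slot 0 :: ('n, 'q) tuple_space) differentiable (at M within S)"
    by (intro differentiable_add differentiable_const bounded_linear_imp_differentiable)
  then show ?thesis
    by simp
qed

lemma partial_product_scale_last_slot:
  assumes "m < CARD('n)"
  shows "partial_product (s *s last_slot M :: ('n::{finite,linorder}, 'q::finite) tuple_space) m = mat (s ^ m)"
  using assms
  by (induction m) (simp_all add: partial_product_Suc component_scale component_last_slot mat_mult_mat)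

text \<open>Each of the n slots contributes one factor \<open>s\<close>. This turns homogeneity of
  degree n in the tuple into degree 1 in the product.\<close>

lemma partial_product_scale_last_slot_CARD:
  "partial_product (s *s last_slot M :: ('n::{finite,linorder}, 'q::finite) tuple_space) CARD('n)
     = mat (s ^ CARD('n)) ** M"
proof -
  obtain m where m: "CARD('n) = Suc m"
    using gr0_implies_Suc[OF zero_less_card_finite] by blast
  then have "partial_product (s *s last_slot M :: ('n, 'q) tuple_space) CARD('n) = mat s ** M ** mat (s ^ m)"
    by (simp add: partial_product_Suc[where 'n='n] partial_product_scale_last_slot[where 'n='n] component_scale
        component_last_slot)
  also have "\<dots> = mat (s ^ m) ** mat s ** M"
    by (simp only: mat_mult_commute[of "mat s ** M"] matrix_mul_assoc)
  finally show ?thesis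
    by (simp add: m mat_mult_mat mult.commute)
qed

text \<open>Gauging by the inverses of the partial products turns all factors but the last into 1.\<close>

lemma gauge_invariant_eq_last_slot:
  fixes P :: "('n::{finite,linorder}, 'q::finite) tuple_space \<Rightarrow> complex"
  assumes P: "\<And>h k x. (\<And>m. m \<le> CARD('n) \<Longrightarrow> h m ** k m = mat 1) \<Longrightarrow> h CARD('n) = h 0 \<Longrightarrow>
      P (gauge_matrix h k *v x) = P x"
    and inv: "\<And>m. m < CARD('n) \<Longrightarrow> invertible (partial_product x m)"
  shows "P x = P (last_slot (partial_product x CARD('n)))"
proof -
  \<comment> \<open>At index n the identity replaces the full product, which may be singular. This
    gives \<open>h CARD('n) = h 0\<close> and leaves the full product in the last slot.\<close>
  define k where "k m = (if m = CARD('n) then mat 1 else partial_product x m)" for m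
  define h where "h m = (if m = CARD('n) then mat 1 else matrix_inv (partial_product x m))" for m
  have h0: "h 0 = mat 1"
    by (auto simp: h_def intro: matrix_inv_eqI)
  have "gauge_matrix h k *v x = last_slot (partial_product x CARD('n))"
  proof (rule component_eqI)
    fix \<alpha> :: 'n
    have "component (gauge_matrix h k *v x) \<alpha> = h (Suc (pos \<alpha>)) ** component x \<alpha> ** partial_product x (pos \<alpha>)"
      using less_imp_neq[OF pos_less[of \<alpha>]] by (simp add: component_gauge k_def)
    also have "\<dots> = h (Suc (pos \<alpha>)) ** partial_product x (Suc (pos \<alpha>))"
      by (simp add: partial_product_Suc matrix_mul_assoc)
    also have "\<dots> = component (last_slot (partial_product x CARD('n)) :: ('n, 'q) tuple_space) \<alpha>"
      using Suc_leI[OF pos_less[of \<alpha>]] inv[of "Suc (pos \<alpha>)"]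
      by (auto simp: component_last_slot h_def order_le_less matrix_inv_left)
    finally show "component (gauge_matrix h k *v x) \<alpha>
        = component (last_slot (partial_product x CARD('n)) :: ('n, 'q) tuple_space) \<alpha>" .
  qed
  moreover have "P (gauge_matrix h k *v x) = P x"
    by (rule P) (auto simp: h0, auto simp: h_def k_def inv matrix_inv_left)
  ultimately show ?thesis
    by simp
qed

lemma continuous_on_partial_product_entry:
  fixes X :: "'b::topological_space \<Rightarrow> ('n::{finite,linorder}, 'q::finite) tuple_space"
  assumes "continuous_on S X" "m \<le> CARD('n)"
  shows "continuous_on S (\<lambda>z. partial_product (X z) m $ i $ j)"
  using assms(2)
proof (induction m arbitrary: i j)
  case (Suc m)
  have "continuous_on S (\<lambda>z. \<Sum>k\<in>UNIV. X z $ (sorted_list_of_set UNIV ! m, i, k) * partial_product (X z) m $ k $ j)"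
    using Suc by (intro continuous_on_sum continuous_on_mult continuous_on_component[OF assms(1)]) auto
  then show ?case
    using Suc.prems by (simp add: partial_product_Suc matrix_matrix_mult_def component_def)
qed simp

section \<open>Identification of the invariant polynomials\<close>

theorem proposition2p10:
  fixes P :: "('n::{finite,linorder}, 'q::finite) tuple_space \<Rightarrow> complex"
  assumes "P \<in> sym_power CARD('n)"
    and "\<forall>g \<in> stabilizer0 (IMM :: ('n, 'q) tuple_space \<Rightarrow> complex). act g P = P"
  shows "\<exists>c :: complex. P = (\<lambda>x. c * IMM x)"
proof -
  define f where "f M = P (last_slot M)" for M
  have gauge_inv: "P (gauge_matrix h k *v x) = P x"
    if "\<And>m. m \<le> CARD('n) \<Longrightarrow> h m ** k m = mat 1" "h CARD('n) = h 0" for h k x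
  proof -
    have "act (transpose (gauge_matrix h k)) P = P"
      using assms(2) gauge_in_stabilizer0[of h k, where 'n='n] that by blast
    then show ?thesis
      unfolding act_def by (metis transpose_transpose)
  qed
  have normal_form: "P x = f (partial_product x CARD('n))"
    if "\<And>m. m < CARD('n) \<Longrightarrow> invertible (partial_product x m)" for x
    unfolding f_def by (rule gauge_invariant_eq_last_slot[OF gauge_inv that])
  have scale_nz: "f (mat s ** M) = s * f M" if "s \<noteq> 0" for s M
  proof -
    \<comment> \<open>An n-th root of \<open>s\<close>: scaling the tuple by \<open>r\<close>
      multiplies its product by \<open>s\<close>.\<close>
    define r where "r = exp (Ln s / of_nat CARD('n))"
    have r: "r ^ CARD('n) = s" "r \<noteq> 0"
      using that by (simp_all add: r_def exp_of_nat_mult[symmetric])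
    have "P (r *s last_slot M) = f (mat (r ^ CARD('n)) ** M)"
      using r(2) by (subst normal_form)
        (simp_all add: partial_product_scale_last_slot partial_product_scale_last_slot_CARD invertible_mat)
    then show ?thesis
      using sym_power_scale[OF assms(1), of r "last_slot M"] r(1) by (simp add: f_def)
  qed
  have "f differentiable (at 0)"
    unfolding f_def
    by (rule differentiable_compose[OF sym_power_differentiable[OF assms(1)] last_slot_differentiable])
  moreover have "f (t *\<^sub>R M) = t *\<^sub>R f M" if "t > 0" for t M
  proof -
    have "t *\<^sub>R M = mat (of_real t) ** M"
      by (simp add: mat_mult_left vec_eq_iff) (simp add: scaleR_conv_of_real)
    then show ?thesis
      using scale_nz[of "of_real t" M] that by (simp add: scaleR_conv_of_real)
  qed
  ultimately have "linear f"
    by (rule linear_if_homogeneous_differentiable)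
  moreover have "f (mat s ** M) = s * f M" for s M
  \<comment> \<open>The root argument needs nonzero \<open>s\<close> to keep the partial products
    invertible; at 0 linearity takes over.\<close>
  proof (cases "s = 0")
    case True
    then have "mat s ** M = 0"
      unfolding mat_mult_left by (simp add: vec_eq_iff)
    then show ?thesis
      using True linear_0[OF \<open>linear f\<close>] by simp
  qed (simp add: scale_nz)
  moreover have "f (A ** M ** B) = f M" if "A ** B = mat 1" for A B M
  proof -
    let ?x = "last_slot M :: ('n, 'q) tuple_space"
    \<comment> \<open>A constant gauge fixes the identity slots and conjugates the last one.\<close>
    have "gauge_matrix (\<lambda>_. A) (\<lambda>_. B) *v ?x = last_slot (A ** M ** B)"
      using that by (intro component_eqI) (simp add: component_gauge component_last_slot)
    then show ?thesis
      using gauge_inv[of "\<lambda>_. A" "\<lambda>_. B" ?x] that by (simp add: f_def)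
  qed
  ultimately obtain c where c: "f M = c * trace M" for M
    using conjugation_invariant_linear_is_trace[of f] by blast
  have "P x = c * IMM x" for x
  proof -
    \<comment> \<open>The complex line from the all-identity tuple at 0 to \<open>x\<close> at 1.
      All components are invertible for all but finitely many \<open>z\<close>, even when those of
      \<open>x\<close> are singular.\<close>
    define X :: "complex \<Rightarrow> ('n, 'q) tuple_space"
      where "X z = (1 - z) *s last_slot (mat 1) + z *s x" for z
    define S where "S = - (\<Union>\<alpha>. {z. \<not> invertible (mat (1 - z) + mat z ** component x \<alpha>)})"
    have comp: "component (X z) \<alpha> = mat (1 - z) + mat z ** component x \<alpha>" for z \<alpha>
    proof -
      have "component (X z) \<alpha>
          = mat (1 - z) ** component (last_slot (mat 1) :: ('n, 'q) tuple_space) \<alpha> + mat z ** component x \<alpha>"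
        by (simp add: X_def component_def vec_eq_iff mat_mult_left algebra_simps)
      then show ?thesis
        by (simp add: component_last_slot)
    qed
    have "finite (- S)"
      unfolding S_def by (simp add: finite_singular_segment)
    have eq: "P (X z) = c * IMM (X z)" if "z \<in> S" for z
    proof -
      have "invertible (partial_product (X z) m)" if "m \<le> CARD('n)" for m
        using that
      proof (induction m)
        case (Suc m)
        then show ?case
          using \<open>z \<in> S\<close> by (auto simp: partial_product_Suc comp S_def intro!: invertible_mult)
      qed (simp add: invertible_mat)
      then show ?thesis
        by (simp add: normal_form IMM_partial_product c)
    qed
    have X: "continuous_on UNIV X"
      unfolding X_def vector_scalar_mult_def by (intro continuous_intros)
    have "continuous_on UNIV P"
      using sym_power_differentiable[OF assms(1)]
      by (auto intro!: differentiable_imp_continuous_on simp: differentiable_on_def)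
    then have "continuous_on UNIV (\<lambda>z. P (X z) - c * IMM (X z))"
      unfolding IMM_partial_product trace_def
      by (intro continuous_intros continuous_on_compose2[OF _ X] continuous_on_partial_product_entry X) auto
    then have closed: "closed ((\<lambda>z. P (X z) - c * IMM (X z)) -` {0})"
      by (simp add: closed_vimage continuous_on_eq_continuous_at)
    \<comment> \<open>A cofinite subset of the plane is dense, so the closed zero set of the
      difference contains every \<open>z\<close>, in particular 1.\<close>
    have "closure S = UNIV"
      using empty_interior_finite[OF \<open>finite (- S)\<close>] by (simp add: closure_interior)
    moreover have "S \<subseteq> (\<lambda>z. P (X z) - c * IMM (X z)) -` {0}"
      using eq by auto
    ultimately have "(1::complex) \<in> (\<lambda>z. P (X z) - c * IMM (X z)) -` {0}"
      using closure_minimal[OF _ closed] by blast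
    moreover have "X 1 = x"
      by (simp add: X_def)
    ultimately show ?thesis
      by simp
  qed
  then show ?thesis
    by blast
qed

end
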